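(* Let $(\Omega,\mathcal{F}_\infty,\{\mathcal{F}_t\}_{t\in[0,\infty)})$ be a filtered measurable space with probability measures $P$ and $\widetilde P$ on $(\Omega,\mathcal{F}_\infty)$. Let $\lambda>0$ and define $\pi(ds)= \lambda e^{-\lambda s}ds$ on $[0,\infty)$. Suppose $f:[0,\infty)\times\Omega\to\overline{\mathbb{R}}$, written $f_s(\omega)$, is progressively measurable and that either $f_s\geq 0$ for $\pi$-a.e. $s$, or $E_{\widetilde{P}}\left[\int_0^\infty |f_s|\,d\pi\right]<\infty$. Then, for each of the two choices of sign, $$\pm E_{\widetilde{P}}\left[\int_0^\infty f_s \lambda e^{-\lambda s}ds\right] \leq\int_0^\infty\inf_{c>0}\left\{\frac{1}{c}\Lambda_P^{f_{s}}(\pm c)+\frac{1}{c} R(\widetilde{P}|_{\mathcal{F}_{s}}\|P|_{\mathcal{F}_{s}})\right\} \lambda e^{-\lambda s}ds$$ $$\leq\inf_{c>0}\left\{\int_0^\infty\frac{1}{c}\Lambda_P^{f_{s}}(\pm c)\lambda e^{-\lambda s}ds+\frac{1}{c} \int_{0}^\infty R(\widetilde{P}|_{\mathcal{F}_{s}}\|P|_{\mathcal{F}_{s}}) \lambda e^{-\lambda s}ds\right\}.$$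
   Context: $\overline{\mathbb{R}}$ denotes the extended real line. $f$ is progressively measurable if $f$ is measurable and, for every $t$, $f|_{[0,t]\times\Omega}$ is $\mathcal{B}([0,t])\otimes\mathcal{F}_t$-measurable. $E_Q$ is expectation under $Q$ and $Q|_{\mathcal{G}}$ is the restriction of $Q$ to the sub sigma-algebra $\mathcal{G}$. The cumulant generating function is $\Lambda_P^F(c)=\log E_P[e^{cF}]$ (natural logarithm, with the continuous extensions of $\exp$ to $\overline{\mathbb{R}}$ and of $\log$ to $[0,\infty]$). The relative entropy is $R(\widetilde P\|P)=E_{\widetilde P}[\log(d\widetilde P/dP)]$ if $\widetilde P\ll P$, and $+\infty$ otherwise. The sum $-\infty+\infty$ is interpreted as $\infty$. A formula with $\pm$ stands for two formulas, one with all upper signs and one with all lower signs. *)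

theory Defs
  imports "HOL-Probability.Probability"
begin

definition exp_ext :: "ereal \<Rightarrow> ennreal" where
  "exp_ext x = (case x of ereal r \<Rightarrow> ennreal (exp r) | PInfty \<Rightarrow> \<infinity> | MInfty \<Rightarrow> 0)"

definition ln_ext :: "ennreal \<Rightarrow> ereal" where
  "ln_ext x = (if x = 0 then -\<infinity> else if x = \<infinity> then \<infinity> else ereal (ln (enn2real x)))"

(* Integral of an extended-real function, positive part minus negative part; e2ennreal sends
   negative arguments to 0.  The convention -\<infinity> + \<infinity> = \<infinity> comes for free, because
   \<infinity> - \<infinity> = \<infinity> and -\<infinity> + \<infinity> = \<infinity> hold in type ereal. *)
definition ext_integral :: "'a measure \<Rightarrow> ('a \<Rightarrow> ereal) \<Rightarrow> ereal" where
  "ext_integral M g =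
     enn2ereal (\<integral>\<^sup>+x. e2ennreal (g x) \<partial>M) - enn2ereal (\<integral>\<^sup>+x. e2ennreal (- g x) \<partial>M)"

definition cgf :: "'a measure \<Rightarrow> ('a \<Rightarrow> ereal) \<Rightarrow> real \<Rightarrow> ereal" where
  "cgf P F c = ln_ext (\<integral>\<^sup>+\<omega>. exp_ext (ereal c * F \<omega>) \<partial>P)"

(* KL_divergence is real-valued and is 0 when the log-density is not integrable, so it cannot
   represent an infinite relative entropy. *)
definition rel_entropy :: "'a measure \<Rightarrow> 'a measure \<Rightarrow> ereal" where
  "rel_entropy Q P =
     (if absolutely_continuous P Q then ext_integral Q (\<lambda>\<omega>. ln_ext (RN_deriv P Q \<omega>)) else \<infinity>)"

(* The locale filtration indexes by a whole type; here the index set is [0,\<infinity>), and F t is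
   irrelevant for t < 0.  Only the sigma-algebra of F t matters, not its measure. *)
definition filtered_space :: "'a measure \<Rightarrow> (real \<Rightarrow> 'a measure) \<Rightarrow> bool" where
  "filtered_space M F \<longleftrightarrow>
     (\<forall>t\<ge>0. subalgebra M (F t)) \<and> (\<forall>s t. 0 \<le> s \<and> s \<le> t \<longrightarrow> sets (F s) \<subseteq> sets (F t))"

definition progressively_measurable ::
  "'a measure \<Rightarrow> (real \<Rightarrow> 'a measure) \<Rightarrow> (real \<Rightarrow> 'a \<Rightarrow> ereal) \<Rightarrow> bool" where
  "progressively_measurable M F f \<longleftrightarrow>
     (\<lambda>(s, \<omega>). f s \<omega>) \<in> borel_measurable (restrict_space borel {0..} \<Otimes>\<^sub>M M) \<and>
     (\<forall>t\<ge>0. (\<lambda>(s, \<omega>). f s \<omega>) \<in> borel_measurable (restrict_space borel {0..t} \<Otimes>\<^sub>M F t))"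

definition exp_measure :: "real \<Rightarrow> real measure" where
  "exp_measure lam =
     density (restrict_space lborel {0..}) (\<lambda>s. ennreal (lam * exp (- lam * s)))"

end

theory Submission
  imports Defs
begin

text \<open>The theorem rests on one inequality for a fixed time \<open>s\<close>, integrated over \<open>s\<close>. Since \<open>f\<^sub>s\<close> is measurable
with respect to \<open>F\<^sub>s\<close>, the Donsker-Varadhan variational formula (lemma \<open>donsker_varadhan\<close>) can be
applied to \<open>\<plusminus> c f\<^sub>s\<close> and to the restrictions of both measures to \<open>F\<^sub>s\<close>; after division by \<open>c\<close> it bounds
\<open>\<plusminus> E\<^sub>Q[f\<^sub>s]\<close> by the expression under the infimum, for every \<open>c > 0\<close> (lemma
\<open>donsker_varadhan_subalgebra\<close>). Taking the infimum, integrating in \<open>s\<close> and exchanging the order of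
integration on the left (lemma \<open>ext_integral_Fubini\<close>) gives the first inequality. For the second one,
the infimum is bounded by its value at one \<open>c\<close> that does not depend on \<open>s\<close>, and the integral of the sum
is split (lemma \<open>ext_integral_add_le\<close>).

Two points need attention. First, all quantities may be infinite. The rules for the integral are
therefore proved from identities between positive and negative parts. Second, splitting the sum requires that both of its terms are measurable in \<open>s\<close>. For the
cumulant generating function this is part of Tonelli's theorem. For the relative entropy it follows
from monotonicity in \<open>s\<close> (lemma \<open>rel_entropy_mono_subalgebra\<close>), which is again an instance of the
Donsker-Varadhan inequality, with the log-density on the smaller sigma-algebra as test function.\<close>

section \<open>Integrals of extended-real functions\<close>

lemma measurable_exp_ext [measurable]: "exp_ext \<in> borel_measurable borel"
proof -
  have "exp_ext = (\<lambda>x. if x = \<infinity> then \<infinity> else if x = -\<infinity> then 0 else ennreal (exp (real_of_ereal x)))"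
    by (auto simp: fun_eq_iff exp_ext_def split: ereal.split)
  also have "\<dots> \<in> borel_measurable borel" by measurable
  finally show ?thesis .
qed

lemma measurable_ln_ext [measurable]: "ln_ext \<in> borel_measurable borel"
  unfolding ln_ext_def by measurable

lemma exp_ext_ln_ext: "exp_ext (ln_ext x) = x"
  by (cases x) (auto simp: exp_ext_def ln_ext_def)

lemma ln_ext_1 [simp]: "ln_ext 1 = 0"
  by (simp add: ln_ext_def)

lemma exp_ext_0 [simp]: "exp_ext 0 = 1"
  by (simp add: exp_ext_def zero_ereal_def)

lemma ext_integral_cong:
  assumes "\<And>x. x \<in> space M \<Longrightarrow> g x = h x"
  shows "ext_integral M g = ext_integral M h"
  unfolding ext_integral_def using assms by (auto cong: nn_integral_cong)

text \<open>The non-negative integral is a supremum over simple functions, hence monotone for arbitrary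
functions. In this generality the lemma applies to an infimum over uncountably many functions.\<close>

lemma ext_integral_mono:
  assumes "\<And>x. x \<in> space M \<Longrightarrow> g x \<le> h x"
  shows "ext_integral M g \<le> ext_integral M h"
  unfolding ext_integral_def using assms
  by (intro ereal_minus_mono) (auto simp: less_eq_ennreal.rep_eq[symmetric] intro!: nn_integral_mono e2ennreal_mono)

lemma ext_integral_nonneg:
  assumes "\<And>x. x \<in> space M \<Longrightarrow> 0 \<le> g x"
  shows "ext_integral M g = enn2ereal (\<integral>\<^sup>+x. e2ennreal (g x) \<partial>M)"
proof -
  have "(\<integral>\<^sup>+x. e2ennreal (- g x) \<partial>M) = (\<integral>\<^sup>+x. 0 \<partial>M)"
    using assms by (intro nn_integral_cong e2ennreal_neg) (simp)
  then show ?thesis by (simp add: ext_integral_def zero_ennreal.rep_eq)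
qed

text \<open>If the integrand is given as \<open>u - v\<close>, its positive part \<open>p\<close> and negative part \<open>n\<close> may be smaller
than \<open>u\<close> and \<open>v\<close>, but \<open>p + v = u + n\<close> pointwise, also at the points where \<open>u = v = \<infinity>\<close>.
Integrating this balance gives the claim as soon as one side is finite.\<close>

lemma ext_integral_diff:
  assumes [measurable]: "u \<in> borel_measurable M" "v \<in> borel_measurable M"
    and fin: "(\<integral>\<^sup>+x. u x \<partial>M) < \<infinity> \<or> (\<integral>\<^sup>+x. v x \<partial>M) < \<infinity>"
  shows "ext_integral M (\<lambda>x. enn2ereal (u x) - enn2ereal (v x)) =
    enn2ereal (\<integral>\<^sup>+x. u x \<partial>M) - enn2ereal (\<integral>\<^sup>+x. v x \<partial>M)"
proof -
  define p where "p x = e2ennreal (enn2ereal (u x) - enn2ereal (v x))" for x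
  define n where "n x = e2ennreal (- (enn2ereal (u x) - enn2ereal (v x)))" for x
  have [measurable]: "p \<in> borel_measurable M" "n \<in> borel_measurable M"
    unfolding p_def n_def by measurable
  have pn: "p x + v x = u x + n x \<and> p x \<le> u x \<and> n x \<le> v x" for x
  proof (cases "u x")
    case (real r)
    show ?thesis
    proof (cases "v x")
      case (real s)
      then show ?thesis using \<open>u x = ennreal r\<close> \<open>0 \<le> r\<close>
        by (cases "r \<le> s") (auto simp: p_def n_def ennreal_neg ennreal_plus[symmetric] simp del: ennreal_plus intro!: ennreal_leI)
    qed (simp add: real p_def n_def e2ennreal_neg)
  next
    case top
    then show ?thesis
      by (cases "v x") (simp_all add: p_def n_def e2ennreal_neg)
  qed
  then have bal: "p x + v x = u x + n x" and p_le: "p x \<le> u x" and n_le: "n x \<le> v x" for x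
    by auto
  have "(\<integral>\<^sup>+x. p x \<partial>M) + (\<integral>\<^sup>+x. v x \<partial>M) = (\<integral>\<^sup>+x. u x \<partial>M) + (\<integral>\<^sup>+x. n x \<partial>M)"
    using bal by (simp add: nn_integral_add[symmetric])
  moreover have "(\<integral>\<^sup>+x. p x \<partial>M) \<le> (\<integral>\<^sup>+x. u x \<partial>M)" "(\<integral>\<^sup>+x. n x \<partial>M) \<le> (\<integral>\<^sup>+x. v x \<partial>M)"
    by (intro nn_integral_mono p_le n_le)+
  ultimately have "enn2ereal (\<integral>\<^sup>+x. p x \<partial>M) - enn2ereal (\<integral>\<^sup>+x. n x \<partial>M) =
      enn2ereal (\<integral>\<^sup>+x. u x \<partial>M) - enn2ereal (\<integral>\<^sup>+x. v x \<partial>M)"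
    using fin
    by (cases "\<integral>\<^sup>+x. p x \<partial>M"; cases "\<integral>\<^sup>+x. n x \<partial>M"; cases "\<integral>\<^sup>+x. u x \<partial>M"; cases "\<integral>\<^sup>+x. v x \<partial>M")
       (auto simp: ennreal_plus[symmetric] top_unique simp del: ennreal_plus)
  then show ?thesis
    by (simp add: ext_integral_def p_def n_def)
qed

lemma ext_integral_cmult:
  assumes [measurable]: "g \<in> borel_measurable M" and "0 < c"
  shows "ext_integral M (\<lambda>x. ereal c * g x) = ereal c * ext_integral M g"
proof -
  have sc: "e2ennreal (ereal c * y) = ennreal c * e2ennreal y" for y
    using \<open>0 < c\<close> by (cases y) (auto simp: ennreal_mult' ennreal_mult_top e2ennreal_neg)
  have "e2ennreal (- (ereal c * g x)) = ennreal c * e2ennreal (- g x)" for x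
    using sc[of "- g x"] by simp
  then have "ext_integral M (\<lambda>x. ereal c * g x) =
     enn2ereal (ennreal c * (\<integral>\<^sup>+x. e2ennreal (g x) \<partial>M)) - enn2ereal (ennreal c * (\<integral>\<^sup>+x. e2ennreal (- g x) \<partial>M))"
    by (simp add: ext_integral_def sc nn_integral_cmult)
  also have "\<dots> = ereal c * ext_integral M g"
    unfolding ext_integral_def using \<open>0 < c\<close>
    by (cases "\<integral>\<^sup>+x. e2ennreal (g x) \<partial>M"; cases "\<integral>\<^sup>+x. e2ennreal (- g x) \<partial>M")
      (auto simp: ennreal_mult_top ennreal_mult[symmetric] right_diff_distrib)
  finally show ?thesis .
qed

text \<open>If the positive part of \<open>g\<close> or the function \<open>h\<close> has an infinite integral, the right-hand side is
\<open>\<infinity>\<close>, by the convention \<open>-\<infinity> + \<infinity> = \<infinity>\<close>; otherwise \<open>g + h\<close> is the difference of the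
functions \<open>g\<^sup>+ + h\<close> and \<open>g\<^sup>-\<close>, the first of which has a finite integral. In the former case the
sum on the left may cancel, so that equality fails in general.\<close>

lemma ext_integral_add_le:
  assumes [measurable]: "g \<in> borel_measurable M" "h \<in> borel_measurable M"
    and nonneg: "\<And>x. x \<in> space M \<Longrightarrow> 0 \<le> h x"
  shows "ext_integral M (\<lambda>x. g x + h x) \<le> ext_integral M g + ext_integral M h"
proof (cases "(\<integral>\<^sup>+x. e2ennreal (g x) \<partial>M) = \<infinity> \<or> (\<integral>\<^sup>+x. e2ennreal (h x) \<partial>M) = \<infinity>")
  case True
  then have "ext_integral M g + ext_integral M h = \<infinity>"
    by (auto simp: ext_integral_nonneg[of M h, OF nonneg]) (simp add: ext_integral_def)
  then show ?thesis by (simp only: ereal_less_eq)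
next
  case False
  then have fin: "(\<integral>\<^sup>+x. e2ennreal (g x) + e2ennreal (h x) \<partial>M) < \<infinity>"
    by (simp add: nn_integral_add less_top)
  have "g x + h x = enn2ereal (e2ennreal (g x) + e2ennreal (h x)) - enn2ereal (e2ennreal (- g x))"
    if "x \<in> space M" for x
    using nonneg[OF that]
    by (cases "g x"; cases "h x"; cases "g x \<le> 0")
       (auto simp: plus_ennreal.rep_eq ennreal_neg e2ennreal_neg zero_ennreal.rep_eq)
  then have "ext_integral M (\<lambda>x. g x + h x) =
     enn2ereal (\<integral>\<^sup>+x. e2ennreal (g x) + e2ennreal (h x) \<partial>M) - enn2ereal (\<integral>\<^sup>+x. e2ennreal (- g x) \<partial>M)"
    using fin by (subst ext_integral_diff[symmetric]) (auto intro!: ext_integral_cong)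
  also have "\<dots> = ext_integral M g + ext_integral M h"
    using False unfolding ext_integral_nonneg[of M h, OF nonneg, simplified]
    unfolding ext_integral_def
    by (cases "\<integral>\<^sup>+x. e2ennreal (g x) \<partial>M"; cases "\<integral>\<^sup>+x. e2ennreal (h x) \<partial>M"; cases "\<integral>\<^sup>+x. e2ennreal (- g x) \<partial>M")
       (auto simp: nn_integral_add ennreal_plus[symmetric] simp del: ennreal_plus)
  finally show ?thesis by simp
qed

section \<open>The Donsker-Varadhan inequality and relative entropy\<close>

text \<open>One half of the Donsker-Varadhan variational formula. Where a term on the right is \<open>\<infinity>\<close>, so is the
sum, by the convention \<open>-\<infinity> + \<infinity> = \<infinity>\<close>. Otherwise write \<open>Z = dQ/dP\<close>,
\<open>A = E\<^sub>P[exp F]\<close> and \<open>a = ln A\<close>. Applying \<open>t \<le> exp t - 1\<close> to \<open>t = F - a - ln Z\<close> gives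
\<open>F \<le> a + ln Z + (W - 1)\<close> with \<open>W = exp F / (A Z)\<close>, and \<open>E\<^sub>Q[W] \<le> E\<^sub>P[exp F / A] = 1\<close>. Taking
\<open>Q\<close>-expectations yields the inequality. To keep all integrals meaningful, the pointwise inequality
is rearranged into one between sums of positive and negative parts, that is, between
non-negative functions.\<close>

lemma donsker_varadhan:
  assumes "prob_space P" "prob_space Q" and sets: "sets Q = sets P"
    and [measurable]: "F \<in> borel_measurable P"
  shows "ext_integral Q F \<le> cgf P F 1 + rel_entropy Q P"
proof (cases "absolutely_continuous P Q \<and> rel_entropy Q P < \<infinity> \<and> cgf P F 1 < \<infinity>")
  case False
  then have "cgf P F 1 + rel_entropy Q P = \<infinity>"
    by (auto simp: rel_entropy_def)
  then show ?thesis by (simp only: ereal_less_eq)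
next
  case True
  interpret P: prob_space P by fact
  interpret Q: prob_space Q by fact
  note [measurable_cong] = sets
  define Z where "Z = RN_deriv P Q"
  have [measurable]: "Z \<in> borel_measurable P" by (simp add: Z_def)
  have Q_eq: "Q = density P Z"
    using P.density_RN_deriv[of Q] True sets by (simp add: Z_def)
  have Z_pos: "AE x in Q. Z x \<noteq> 0"
    by (subst Q_eq) (auto simp: AE_density)
  have "AE x in P. Z x \<noteq> \<infinity>"
    unfolding Z_def using True sets Q.sigma_finite_measure by (intro P.RN_deriv_finite) auto
  then have Z_fin: "AE x in Q. Z x \<noteq> \<infinity>"
    by (subst Q_eq) (auto simp: AE_density)
  define lp where "lp = (\<integral>\<^sup>+x. e2ennreal (ln_ext (Z x)) \<partial>Q)"
  define lm where "lm = (\<integral>\<^sup>+x. e2ennreal (- ln_ext (Z x)) \<partial>Q)"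
  have R_eq: "rel_entropy Q P = enn2ereal lp - enn2ereal lm"
    using True by (simp add: rel_entropy_def ext_integral_def lp_def lm_def Z_def)
  \<comment> \<open>The negative part of \<open>ln Z\<close> is always \<open>Q\<close>-integrable, because \<open>- z ln z \<le> 1 - z\<close>.\<close>
  have "lm \<le> (\<integral>\<^sup>+x. 1 \<partial>P)"
  proof -
    have "lm = (\<integral>\<^sup>+x. Z x * e2ennreal (- ln_ext (Z x)) \<partial>P)"
      unfolding lm_def by (subst Q_eq) (simp add: nn_integral_density)
    also have "\<dots> \<le> (\<integral>\<^sup>+x. 1 \<partial>P)"
    proof (intro nn_integral_mono)
      fix x
      show "Z x * e2ennreal (- ln_ext (Z x)) \<le> 1"
      proof (cases "Z x")
        case (real r)
        show ?thesis
        proof (cases "r = 0")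
          case False
          then have "r > 0" using real by simp
          then have "ln (1 / r) \<le> 1 / r - 1" by (intro ln_le_minus_one) simp
          then have "r * - ln r \<le> 1" using \<open>r > 0\<close>
            by (simp add: ln_div field_simps)
          then show ?thesis using \<open>r > 0\<close> real
            by (simp add: ln_ext_def ennreal_mult'[symmetric])
        qed (simp add: real)
      qed (simp add: ln_ext_def e2ennreal_neg)
    qed
    finally show ?thesis .
  qed
  then have lm_fin: "lm < \<infinity>" by (simp add: P.emeasure_space_1 order_le_less_trans)
  have lp_fin: "lp < \<infinity>"
    using True R_eq by (cases lp) auto
  define A where "A = (\<integral>\<^sup>+x. exp_ext (F x) \<partial>P)"
  have cgf_eq: "cgf P F 1 = ln_ext A" by (simp add: cgf_def A_def one_ereal_def[symmetric])
  have "A < \<infinity>" using True by (cases "A = \<infinity>") (auto simp: cgf_eq ln_ext_def less_top)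
  define Fp where "Fp = (\<integral>\<^sup>+x. e2ennreal (F x) \<partial>Q)"
  define Fn where "Fn = (\<integral>\<^sup>+x. e2ennreal (- F x) \<partial>Q)"
  have F_eq: "ext_integral Q F = enn2ereal Fp - enn2ereal Fn" 
    by (simp add: ext_integral_def Fp_def Fn_def)
  show ?thesis
  proof (cases "A = 0")
    case True
    then have "AE x in P. exp_ext (F x) = 0"
      by (simp add: A_def nn_integral_0_iff_AE)
    \<comment> \<open>The right-hand side is \<open>-\<infinity>\<close> here, and so is the left-hand side.\<close>
    then have "AE x in P. F x = -\<infinity>"
      by eventually_elim (auto simp: exp_ext_def split: ereal.splits)
    then have ae: "AE x in Q. F x = -\<infinity>"
      by (subst Q_eq) (auto simp: AE_density)
    have "Fn = (\<integral>\<^sup>+x. \<infinity> \<partial>Q)"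
      unfolding Fn_def by (intro nn_integral_cong_AE) (use ae in \<open>auto\<close>)
    moreover have "Fp = (\<integral>\<^sup>+x. 0 \<partial>Q)"
      unfolding Fp_def by (intro nn_integral_cong_AE) (use ae in \<open>auto simp: e2ennreal_neg\<close>)
    ultimately show ?thesis unfolding F_eq by (simp add: Q.emeasure_space_1 zero_ennreal.rep_eq)
  next
    case False
    obtain a where a: "A = ennreal (exp a)" and a_eq: "ln_ext A = ereal a"
    proof
      show "A = ennreal (exp (ln (enn2real A)))" "ln_ext A = ereal (ln (enn2real A))"
        using False \<open>A < \<infinity>\<close> by (cases A; auto simp: ln_ext_def)+
    qed
    define W where "W x = exp_ext (F x) / (A * Z x)" for x
    have [measurable]: "W \<in> borel_measurable P" unfolding W_def by measurable
    have W_le: "(\<integral>\<^sup>+x. W x \<partial>Q) \<le> 1"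
    proof -
      have "(\<integral>\<^sup>+x. W x \<partial>Q) = (\<integral>\<^sup>+x. Z x * W x \<partial>P)"
        by (subst Q_eq) (simp add: nn_integral_density)
      also have "\<dots> \<le> (\<integral>\<^sup>+x. exp_ext (F x) / A \<partial>P)"
      proof (intro nn_integral_mono)
        fix x
        show "Z x * W x \<le> exp_ext (F x) / A"
        proof (cases "Z x")
          case (real r)
          show ?thesis
          proof (cases "exp_ext (F x)")
            case (real e) 
            then show ?thesis using \<open>Z x = ennreal r\<close> \<open>0 \<le> r\<close>
              by (cases "r = 0") (auto simp: W_def a ennreal_mult[symmetric] divide_ennreal)
          next
            case top
            then show ?thesis by (simp add: a ennreal_top_divide)
          qed
        qed (simp add: W_def a ennreal_mult_top)
      qed
      also have "\<dots> = A / A" by (simp add: nn_integral_divide A_def)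
      also have "\<dots> = 1" using False \<open>A < \<infinity>\<close> by (simp add: a divide_ennreal)
      finally show ?thesis .
    qed
    \<comment> \<open>The first inequality only serves to show that \<open>F\<close> has a \<open>Q\<close>-integrable positive part;
      the second is the rearranged form of \<open>F \<le> a + ln Z + (W - 1)\<close>.\<close>
    have young: "e2ennreal (F x) \<le> e2ennreal (ln_ext (Z x)) + ennreal a + W x \<and>
        e2ennreal (F x) + e2ennreal (- ln_ext (Z x)) + ennreal (- a) + 1
        \<le> e2ennreal (- F x) + e2ennreal (ln_ext (Z x)) + ennreal a + W x"
      if "Z x \<noteq> 0" "Z x \<noteq> \<infinity>" for x
    proof -
      obtain r where r: "Z x = ennreal r" "r > 0"
        using \<open>Z x \<noteq> 0\<close> \<open>Z x \<noteq> \<infinity>\<close> by (cases "Z x") (auto simp: less_le)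
      have l: "ln_ext (Z x) = ereal (ln r)" using r by (simp add: ln_ext_def)
      show ?thesis
      proof (cases "F x")
        case (real y)
        define w where "w = exp (y - a - ln r)"
        have w: "W x = ennreal w" "w > 0" "y - a - ln r \<le> w - 1"
          using r real exp_ge_add_one_self[of "y - a - ln r"]
          by (auto simp: W_def w_def exp_ext_def a ennreal_mult[symmetric] divide_ennreal exp_diff exp_add field_simps)
        show ?thesis unfolding l real w(1) uminus_ereal.simps e2ennreal_ereal
          using w(2,3)
          by (cases "y \<ge> 0"; cases "ln r \<ge> 0"; cases "a \<ge> 0")
             (auto simp: ennreal_neg ennreal_plus[symmetric] ennreal_1[symmetric] simp del: ennreal_plus ennreal_1 intro!: ennreal_leI)
      next
        case PInf
        then have "W x = \<infinity>" using r by (simp add: W_def exp_ext_def a ennreal_mult[symmetric] ennreal_top_divide)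
        then show ?thesis by simp
      next
        case MInf
        then show ?thesis by (simp add: e2ennreal_neg)
      qed
    qed
    have ae: "AE x in Q. Z x \<noteq> 0 \<and> Z x \<noteq> \<infinity>" using Z_pos Z_fin by simp
    define w where "w = (\<integral>\<^sup>+x. W x \<partial>Q)"
    have "Fp \<le> (\<integral>\<^sup>+x. e2ennreal (ln_ext (Z x)) + ennreal a + W x \<partial>Q)"
      unfolding Fp_def by (intro nn_integral_mono_AE) (use ae young in auto)
    also have "\<dots> = lp + ennreal a + w"
      by (simp add: nn_integral_add lp_def w_def Q.emeasure_space_1)
    finally have le1: "Fp \<le> lp + ennreal a + w" .
    have "(\<integral>\<^sup>+x. e2ennreal (F x) + e2ennreal (- ln_ext (Z x)) + ennreal (- a) + 1 \<partial>Q)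
      \<le> (\<integral>\<^sup>+x. e2ennreal (- F x) + e2ennreal (ln_ext (Z x)) + ennreal a + W x \<partial>Q)"
      by (intro nn_integral_mono_AE) (use ae young in auto)
    then have le2: "Fp + lm + ennreal (- a) + 1 \<le> Fn + lp + ennreal a + w"
      by (simp add: nn_integral_add lp_def lm_def w_def Fp_def Fn_def Q.emeasure_space_1)
    have w: "w \<le> 1" using W_le by (simp add: w_def)
    then have "w < \<infinity>" by (simp add: order_le_less_trans)
    with le1 lp_fin have "Fp < \<infinity>" by (auto simp: order_le_less_trans)
    then show ?thesis
      unfolding F_eq R_eq cgf_eq a_eq
      using le2 w lp_fin lm_fin \<open>w < \<infinity>\<close>
      by (cases Fp; cases Fn; cases lp; cases lm; cases w; cases "a \<ge> 0")
        (auto simp: ennreal_neg ennreal_plus[symmetric] ennreal_1[symmetric] simp del: ennreal_plus ennreal_1)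
  qed
qed

lemma donsker_varadhan_scaled:
  assumes "prob_space P" "prob_space Q" and [measurable_cong]: "sets Q = sets P"
    and [measurable]: "F \<in> borel_measurable P" and "0 < c"
  shows "ext_integral Q F \<le> ereal (1 / c) * cgf P F c + ereal (1 / c) * rel_entropy Q P"
proof -
  have "ereal c * ext_integral Q F = ext_integral Q (\<lambda>x. ereal c * F x)"
    using \<open>0 < c\<close> by (simp add: ext_integral_cmult)
  also have "\<dots> \<le> cgf P (\<lambda>x. ereal c * F x) 1 + rel_entropy Q P"
    using assms by (intro donsker_varadhan) auto
  also have "cgf P (\<lambda>x. ereal c * F x) 1 = cgf P F c"
    by (simp add: cgf_def one_ereal_def[symmetric])
  finally have "ereal c * ext_integral Q F \<le> cgf P F c + rel_entropy Q P" .
  then show ?thesis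
    using \<open>0 < c\<close>
    by (cases "ext_integral Q F"; cases "cgf P F c"; cases "rel_entropy Q P") (auto simp: field_simps)
qed

text \<open>The Donsker-Varadhan inequality for \<open>F = 0\<close>.\<close>

lemma rel_entropy_nonneg:
  assumes "prob_space P" "prob_space Q" "sets Q = sets P"
  shows "0 \<le> rel_entropy Q P"
proof -
  have "ext_integral Q (\<lambda>_. 0) \<le> cgf P (\<lambda>_. 0) 1 + rel_entropy Q P"
    using assms by (intro donsker_varadhan) auto
  then show ?thesis
    using assms(1) by (simp add: ext_integral_nonneg cgf_def prob_space.emeasure_space_1 zero_ennreal.rep_eq)
qed

lemma ext_integral_restr_to_subalg:
  assumes "subalgebra M G" and [measurable]: "g \<in> borel_measurable G"
  shows "ext_integral (restr_to_subalg M G) g = ext_integral M g"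
  unfolding ext_integral_def using assms(1) by (simp add: nn_integral_subalgebra2)

lemma cgf_restr_to_subalg:
  assumes "subalgebra M G" and [measurable]: "g \<in> borel_measurable G"
  shows "cgf (restr_to_subalg M G) g c = cgf M g c"
  unfolding cgf_def using assms(1) by (simp add: nn_integral_subalgebra2)

text \<open>Data processing: the log-density \<open>ln Z\<close> on the smaller sigma-algebra \<open>G\<close> is an admissible test
function for the Donsker-Varadhan inequality on the larger one \<open>H\<close>. Its expectation under \<open>Q\<close> is the
entropy on \<open>G\<close>, and its cumulant generating function at \<open>1\<close> is \<open>ln E\<^sub>P[Z] = 0\<close>.\<close>

lemma rel_entropy_mono_subalgebra:
  assumes "prob_space P" "prob_space Q"
    and GP: "subalgebra P G" and GQ: "subalgebra Q G" and HP: "subalgebra P H" and HQ: "subalgebra Q H"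
    and le: "sets G \<subseteq> sets H"
  shows "rel_entropy (restr_to_subalg Q G) (restr_to_subalg P G)
       \<le> rel_entropy (restr_to_subalg Q H) (restr_to_subalg P H)"
proof (cases "absolutely_continuous (restr_to_subalg P H) (restr_to_subalg Q H)")
  case False
  then show ?thesis by (simp add: rel_entropy_def)
next
  case True
  then have ac: "absolutely_continuous (restr_to_subalg P G) (restr_to_subalg Q G)"
    using le by (auto simp: absolutely_continuous_def null_sets_restr_to_subalg GP GQ HP HQ)
  interpret PG: prob_space "restr_to_subalg P G" by (rule prob_space_restr_to_subalg) fact+
  interpret QG: prob_space "restr_to_subalg Q G" by (rule prob_space_restr_to_subalg) fact+
  define Z where "Z = RN_deriv (restr_to_subalg P G) (restr_to_subalg Q G)"
  have ZG[measurable]: "Z \<in> borel_measurable G"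
    unfolding Z_def using borel_measurable_RN_deriv measurable_in_subalg'[OF GP] by blast
  have "subalgebra H G" using GP HP le by (simp add: subalgebra_def)
  then have ZH[measurable]: "Z \<in> borel_measurable H" using ZG by (rule measurable_from_subalg)
  have dens: "density (restr_to_subalg P G) Z = restr_to_subalg Q G"
    unfolding Z_def using ac by (intro PG.density_RN_deriv) (simp_all add: sets_restr_to_subalg GP GQ)
  have "rel_entropy (restr_to_subalg Q G) (restr_to_subalg P G)
     = ext_integral (restr_to_subalg Q G) (\<lambda>x. ln_ext (Z x))"
    using ac by (simp add: rel_entropy_def Z_def)
  also have "\<dots> = ext_integral (restr_to_subalg Q H) (\<lambda>x. ln_ext (Z x))"
    by (simp add: ext_integral_restr_to_subalg GQ HQ)
  also have "\<dots> \<le> cgf (restr_to_subalg P H) (\<lambda>x. ln_ext (Z x)) 1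
       + rel_entropy (restr_to_subalg Q H) (restr_to_subalg P H)"
    using assms by (intro donsker_varadhan prob_space_restr_to_subalg)
      (auto simp: sets_restr_to_subalg intro!: measurable_in_subalg)
  also have "cgf (restr_to_subalg P H) (\<lambda>x. ln_ext (Z x)) 1 = cgf (restr_to_subalg P G) (\<lambda>x. ln_ext (Z x)) 1"
    by (simp add: cgf_restr_to_subalg GP HP)
  also have "\<dots> = 0"
  proof -
    have "(\<integral>\<^sup>+x. Z x \<partial>restr_to_subalg P G) = emeasure (density (restr_to_subalg P G) Z) (space P)"
      using measurable_in_subalg[OF GP ZG]
      by (subst emeasure_density) (auto simp: space_restr_to_subalg intro!: nn_integral_cong,
            metis sets.top space_restr_to_subalg)
    also have "\<dots> = 1"
      unfolding dens using QG.emeasure_space_1 GP GQ by (simp add: space_restr_to_subalg subalgebra_def)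
    finally show ?thesis
      by (simp add: cgf_def one_ereal_def[symmetric] exp_ext_ln_ext)
  qed
  finally show ?thesis by simp
qed

text \<open>The test function sees only \<open>G\<close>, so restricting both measures to \<open>G\<close> changes neither its
expectation nor its cumulant generating function, and can only lower the entropy.\<close>

lemma donsker_varadhan_subalgebra:
  assumes "prob_space P" "prob_space Q" and GP: "subalgebra P G" and GQ: "subalgebra Q G"
    and F: "F \<in> borel_measurable G" and "0 < c"
  shows "ext_integral Q F \<le> ereal (1 / c) * cgf P F c
           + ereal (1 / c) * rel_entropy (restr_to_subalg Q G) (restr_to_subalg P G)"
proof -
  have "ext_integral (restr_to_subalg Q G) F \<le> ereal (1 / c) * cgf (restr_to_subalg P G) F c
           + ereal (1 / c) * rel_entropy (restr_to_subalg Q G) (restr_to_subalg P G)"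
    using assms by (intro donsker_varadhan_scaled prob_space_restr_to_subalg)
      (auto simp: sets_restr_to_subalg intro!: measurable_in_subalg)
  then show ?thesis
    using F GP GQ by (simp add: ext_integral_restr_to_subalg cgf_restr_to_subalg)
qed

section \<open>Exchange of integrals and measurability in time\<close>

lemma borel_measurable_mono_real:
  fixes g :: "real \<Rightarrow> ereal"
  assumes "mono g"
  shows "g \<in> borel_measurable borel"
proof (rule borel_measurableI_greater)
  fix a
  have "is_interval {x. a < g x}"
    unfolding is_interval_1 using monoD[OF assms] by (auto intro: less_le_trans)
  then show "{x \<in> space borel. a < g x} \<in> sets borel"
    by (simp add: real_interval_borel_measurable)
qed

lemma space_exp_measure [simp]: "space (exp_measure lam) = {0..}"
  by (simp add: exp_measure_def space_restrict_space)

lemma sets_exp_measure [measurable_cong]: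
  "sets (exp_measure lam) = sets (restrict_space borel {0..})"
  by (simp add: exp_measure_def sets_restrict_space)

lemma sigma_finite_exp_measure: "sigma_finite_measure (exp_measure lam)"
proof -
  interpret R: sigma_finite_measure "restrict_space lborel {0::real..}"
    by (rule sigma_finite_measure_restrict_space) (auto intro: lborel.sigma_finite_measure_axioms)
  show ?thesis
    unfolding exp_measure_def
    by (subst R.sigma_finite_iff_density_finite) (auto intro!: measurable_restrict_space1)
qed

text \<open>Both orders of integration are given by one formula in which the positive and the negative parts
are integrated over the product separately. Replacing \<open>f\<close> by \<open>- f\<close> interchanges the two terms, which
is how the formula serves both signs.\<close>

lemma ext_integral_Fubini:
  assumes "sigma_finite_measure N" "sigma_finite_measure Q"
    and [measurable]: "(\<lambda>(s, \<omega>). f s \<omega>) \<in> borel_measurable (N \<Otimes>\<^sub>M Q)"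
    and fin: "(\<integral>\<^sup>+s. \<integral>\<^sup>+\<omega>. e2ennreal (f s \<omega>) \<partial>Q \<partial>N) < \<infinity> \<or>
              (\<integral>\<^sup>+s. \<integral>\<^sup>+\<omega>. e2ennreal (- f s \<omega>) \<partial>Q \<partial>N) < \<infinity>"
  shows "ext_integral Q (\<lambda>\<omega>. ext_integral N (\<lambda>s. f s \<omega>)) =
           enn2ereal (\<integral>\<^sup>+s. \<integral>\<^sup>+\<omega>. e2ennreal (f s \<omega>) \<partial>Q \<partial>N)
           - enn2ereal (\<integral>\<^sup>+s. \<integral>\<^sup>+\<omega>. e2ennreal (- f s \<omega>) \<partial>Q \<partial>N)" (is ?Q_outer)
    and "ext_integral N (\<lambda>s. ext_integral Q (f s)) =
           enn2ereal (\<integral>\<^sup>+s. \<integral>\<^sup>+\<omega>. e2ennreal (f s \<omega>) \<partial>Q \<partial>N)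
           - enn2ereal (\<integral>\<^sup>+s. \<integral>\<^sup>+\<omega>. e2ennreal (- f s \<omega>) \<partial>Q \<partial>N)" (is ?N_outer)
proof -
  interpret N: sigma_finite_measure N by fact
  interpret Q: sigma_finite_measure Q by fact
  interpret NQ: pair_sigma_finite N Q ..
  have swap:
    "(\<integral>\<^sup>+\<omega>. \<integral>\<^sup>+s. e2ennreal (f s \<omega>) \<partial>N \<partial>Q) = (\<integral>\<^sup>+s. \<integral>\<^sup>+\<omega>. e2ennreal (f s \<omega>) \<partial>Q \<partial>N)"
    "(\<integral>\<^sup>+\<omega>. \<integral>\<^sup>+s. e2ennreal (- f s \<omega>) \<partial>N \<partial>Q) = (\<integral>\<^sup>+s. \<integral>\<^sup>+\<omega>. e2ennreal (- f s \<omega>) \<partial>Q \<partial>N)"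
    by (intro NQ.Fubini'; measurable)+
  show ?Q_outer
    unfolding ext_integral_def[of N "\<lambda>s. f s _"]
    using fin by (subst ext_integral_diff) (auto simp: swap)
  show ?N_outer
    unfolding ext_integral_def[of Q "f _"]
    using fin by (subst ext_integral_diff) auto
qed

lemma minus_le_abs: "- x \<le> \<bar>x\<bar>" for x :: ereal
  by (cases x) auto

lemma borel_measurable_cgf:
  assumes "sigma_finite_measure P"
    and [measurable]: "(\<lambda>(s, \<omega>). f s \<omega>) \<in> borel_measurable (N \<Otimes>\<^sub>M P)"
  shows "(\<lambda>s. cgf P (f s) c) \<in> borel_measurable N"
proof -
  interpret P: sigma_finite_measure P by fact
  show ?thesis unfolding cgf_def by measurable
qed

text \<open>The densities are chosen separately at each time, so measurability in time
cannot be read off from them; but the entropy is non-decreasing in time, and monotone functions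
are Borel. Times are clipped at \<open>0\<close> to obtain a function that is monotone on the whole real line.\<close>

lemma borel_measurable_rel_entropy_filtration:
  assumes "prob_space P" "prob_space Q"
    and P: "\<And>t. 0 \<le> t \<Longrightarrow> subalgebra P (F t)" and Q: "\<And>t. 0 \<le> t \<Longrightarrow> subalgebra Q (F t)"
    and mono: "\<And>s t. 0 \<le> s \<Longrightarrow> s \<le> t \<Longrightarrow> sets (F s) \<subseteq> sets (F t)"
  shows "(\<lambda>s. rel_entropy (restr_to_subalg Q (F s)) (restr_to_subalg P (F s)))
           \<in> borel_measurable (exp_measure lam)"
proof -
  let ?R = "\<lambda>s. rel_entropy (restr_to_subalg Q (F s)) (restr_to_subalg P (F s))"
  have "mono (\<lambda>s. ?R (max 0 s))"
    using assms(1,2) by (intro monoI rel_entropy_mono_subalgebra P Q mono) auto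
  then have "(\<lambda>s. ?R (max 0 s)) \<in> borel_measurable (restrict_space borel {0..})"
    by (intro measurable_restrict_space1 borel_measurable_mono_real)
  also have "?this \<longleftrightarrow> ?R \<in> borel_measurable (restrict_space borel {0..})"
    by (intro measurable_cong) (simp add: space_restrict_space max_def)
  finally show ?thesis
    by (simp add: measurable_cong_sets[OF sets_exp_measure refl])
qed

text \<open>With horizon \<open>t\<close>, the section at the right end point of \<open>[0, t]\<close> is measurable with respect to \<open>F\<^sub>t\<close>.\<close>

lemma progressively_measurable_adapted:
  assumes "progressively_measurable M F f" and "0 \<le> t"
  shows "f t \<in> borel_measurable (F t)"
proof -
  have [measurable]: "(\<lambda>(s, \<omega>). f s \<omega>) \<in> borel_measurable (restrict_space borel {0..t} \<Otimes>\<^sub>M F t)"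
    using assms by (simp add: progressively_measurable_def)
  have "(\<lambda>\<omega>. (\<lambda>(s, \<omega>). f s \<omega>) (t, \<omega>)) \<in> borel_measurable (F t)"
    using \<open>0 \<le> t\<close>
    by (intro measurable_compose[OF measurable_Pair1'[of t "restrict_space borel {0..t}"]])
       (auto simp: space_restrict_space)
  then show ?thesis by simp
qed

section \<open>Expectations of time-discounted observables\<close>

theorem theorem3:
  fixes M P Q :: "'a measure" and F :: "real \<Rightarrow> 'a measure"
    and f :: "real \<Rightarrow> 'a \<Rightarrow> ereal" and lam \<sigma> :: real
  assumes "filtered_space M F"
    and "prob_space P" and "sets P = sets M"
    and "prob_space Q" and "sets Q = sets M"
    and "lam > 0"
    and "progressively_measurable M F f"
    and "(AE s in exp_measure lam. \<forall>\<omega>\<in>space M. 0 \<le> f s \<omega>) \<or>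
         ext_integral Q (\<lambda>\<omega>. ext_integral (exp_measure lam) (\<lambda>s. \<bar>f s \<omega>\<bar>)) < \<infinity>"
    and "\<sigma> \<in> {1, -1}"
  shows "ereal \<sigma> * ext_integral Q (\<lambda>\<omega>. ext_integral (exp_measure lam) (\<lambda>s. f s \<omega>))
         \<le> ext_integral (exp_measure lam)
             (\<lambda>s. INF c\<in>{0<..}. ereal (1 / c) * cgf P (f s) (\<sigma> * c)
                + ereal (1 / c) * rel_entropy (restr_to_subalg Q (F s)) (restr_to_subalg P (F s)))
       \<and> ext_integral (exp_measure lam)
             (\<lambda>s. INF c\<in>{0<..}. ereal (1 / c) * cgf P (f s) (\<sigma> * c)
                + ereal (1 / c) * rel_entropy (restr_to_subalg Q (F s)) (restr_to_subalg P (F s)))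
         \<le> (INF c\<in>{0<..}.
              ext_integral (exp_measure lam) (\<lambda>s. ereal (1 / c) * cgf P (f s) (\<sigma> * c))
            + ereal (1 / c) * ext_integral (exp_measure lam)
                (\<lambda>s. rel_entropy (restr_to_subalg Q (F s)) (restr_to_subalg P (F s))))"
proof -
  define N where "N = exp_measure lam"
  define R where "R s = rel_entropy (restr_to_subalg Q (F s)) (restr_to_subalg P (F s))" for s
  define K where "K s = (INF c\<in>{0<..}. ereal (1 / c) * cgf P (f s) (\<sigma> * c) + ereal (1 / c) * R s)" for s
  interpret P: prob_space P by fact
  interpret Q: prob_space Q by fact
  note N_sf = sigma_finite_exp_measure[of lam, folded N_def]
  interpret NQ: pair_sigma_finite N Q
    using N_sf Q.sigma_finite_measure_axioms by (intro pair_sigma_finite.intro)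
  have spaces: "space P = space M" "space Q = space M"
    using assms(3,5) by (auto dest: sets_eq_imp_space_eq)
  have space_N: "s \<in> space N \<longleftrightarrow> 0 \<le> s" for s by (simp add: N_def)
  have sub: "subalgebra P (F t)" "subalgebra Q (F t)" if "0 \<le> t" for t
    using assms(1,3,5) that by (auto simp: filtered_space_def subalgebra_def spaces)
  have "(\<lambda>(s, \<omega>). f s \<omega>) \<in> borel_measurable (restrict_space borel {0..} \<Otimes>\<^sub>M M)"
    using assms(7) by (simp add: progressively_measurable_def)
  then have fP[measurable]: "(\<lambda>(s, \<omega>). f s \<omega>) \<in> borel_measurable (N \<Otimes>\<^sub>M P)"
    and fQ[measurable]: "(\<lambda>(s, \<omega>). f s \<omega>) \<in> borel_measurable (N \<Otimes>\<^sub>M Q)"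
    by (simp_all add: N_def sets_exp_measure assms(3,5) cong: measurable_cong_sets sets_pair_measure_cong)
  have R_meas[measurable]: "R \<in> borel_measurable N"
    unfolding R_def N_def using assms(1,2,4) sub
    by (intro borel_measurable_rel_entropy_filtration) (auto simp: filtered_space_def)
  have R_nonneg: "0 \<le> R s" if "0 \<le> s" for s
    unfolding R_def using assms(2,4) sub[OF that]
    by (intro rel_entropy_nonneg prob_space_restr_to_subalg) (simp_all add: sets_restr_to_subalg)

  \<comment> \<open>Finiteness of this one integral is all that the exchange of integrals needs, for both signs.\<close>
  have neg_fin: "(\<integral>\<^sup>+s. \<integral>\<^sup>+\<omega>. e2ennreal (- f s \<omega>) \<partial>Q \<partial>N) < \<infinity>"
    using assms(8)
  proof
    assume "AE s in exp_measure lam. \<forall>\<omega>\<in>space M. 0 \<le> f s \<omega>"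
    then have "AE s in N. (\<integral>\<^sup>+\<omega>. e2ennreal (- f s \<omega>) \<partial>Q) = 0"
      unfolding N_def
    proof eventually_elim
      case (elim s)
      then have "(\<integral>\<^sup>+\<omega>. e2ennreal (- f s \<omega>) \<partial>Q) = (\<integral>\<^sup>+\<omega>. 0 \<partial>Q)"
        by (intro nn_integral_cong e2ennreal_neg) (simp add: spaces)
      then show ?case by simp
    qed
    then have "(\<integral>\<^sup>+s. \<integral>\<^sup>+\<omega>. e2ennreal (- f s \<omega>) \<partial>Q \<partial>N) = (\<integral>\<^sup>+s. 0 \<partial>N)"
      by (intro nn_integral_cong_AE)
    then show ?thesis by simp
  next
    assume "ext_integral Q (\<lambda>\<omega>. ext_integral (exp_measure lam) (\<lambda>s. \<bar>f s \<omega>\<bar>)) < \<infinity>"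
    then have "(\<integral>\<^sup>+\<omega>. \<integral>\<^sup>+s. e2ennreal \<bar>f s \<omega>\<bar> \<partial>N \<partial>Q) < \<infinity>"
      by (simp add: ext_integral_nonneg N_def[symmetric] less_top)
    also have "(\<integral>\<^sup>+\<omega>. \<integral>\<^sup>+s. e2ennreal \<bar>f s \<omega>\<bar> \<partial>N \<partial>Q) = (\<integral>\<^sup>+s. \<integral>\<^sup>+\<omega>. e2ennreal \<bar>f s \<omega>\<bar> \<partial>Q \<partial>N)"
      by (intro NQ.Fubini') measurable
    finally have "(\<integral>\<^sup>+s. \<integral>\<^sup>+\<omega>. e2ennreal \<bar>f s \<omega>\<bar> \<partial>Q \<partial>N) < \<infinity>" .
    moreover have "(\<integral>\<^sup>+s. \<integral>\<^sup>+\<omega>. e2ennreal (- f s \<omega>) \<partial>Q \<partial>N) \<le> (\<integral>\<^sup>+s. \<integral>\<^sup>+\<omega>. e2ennreal \<bar>f s \<omega>\<bar> \<partial>Q \<partial>N)"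
      by (intro nn_integral_mono e2ennreal_mono) (rule minus_le_abs)
    ultimately show ?thesis by simp
  qed

  \<comment> \<open>With the sign inside, the lower sign for \<open>f\<close> becomes the upper sign for \<open>- f\<close>.\<close>
  have "ereal \<sigma> * ext_integral Q (\<lambda>\<omega>. ext_integral N (\<lambda>s. f s \<omega>))
     = ext_integral N (\<lambda>s. ext_integral Q (\<lambda>\<omega>. ereal \<sigma> * f s \<omega>))"
  proof -
    let ?U = "\<integral>\<^sup>+s. \<integral>\<^sup>+\<omega>. e2ennreal (f s \<omega>) \<partial>Q \<partial>N" and ?V = "\<integral>\<^sup>+s. \<integral>\<^sup>+\<omega>. e2ennreal (- f s \<omega>) \<partial>Q \<partial>N"
    have lhs: "ext_integral Q (\<lambda>\<omega>. ext_integral N (\<lambda>s. f s \<omega>)) = enn2ereal ?U - enn2ereal ?V"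
      using N_sf Q.sigma_finite_measure_axioms fQ neg_fin by (intro ext_integral_Fubini(1)) auto
    consider "\<sigma> = 1" | "\<sigma> = -1" using assms(9) by auto
    then show ?thesis
    proof cases
      case 1
      have "ext_integral N (\<lambda>s. ext_integral Q (f s)) = enn2ereal ?U - enn2ereal ?V"
        using N_sf Q.sigma_finite_measure_axioms fQ neg_fin by (intro ext_integral_Fubini(2)) auto
      then show ?thesis using lhs 1 by (simp add: one_ereal_def[symmetric])
    next
      case 2
      have "(\<lambda>(s, \<omega>). - f s \<omega>) \<in> borel_measurable (N \<Otimes>\<^sub>M Q)" by measurable
      then have "ext_integral N (\<lambda>s. ext_integral Q (\<lambda>\<omega>. - f s \<omega>)) = enn2ereal ?V - enn2ereal ?U"
        using ext_integral_Fubini(2)[OF N_sf Q.sigma_finite_measure_axioms, of "\<lambda>s \<omega>. - f s \<omega>"] neg_fin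
        by simp
      moreover have "- (enn2ereal ?U - enn2ereal ?V) = enn2ereal ?V - enn2ereal ?U"
        using neg_fin by (cases ?U; cases ?V) auto
      moreover have "ereal \<sigma> * x = - x" for x using 2 by (cases x) auto
      ultimately show ?thesis using lhs by simp
    qed
  qed
  also have "\<dots> \<le> ext_integral N K"
  proof (intro ext_integral_mono)
    fix s assume "s \<in> space N"
    then have s: "0 \<le> s" by (simp add: space_N)
    have [measurable]: "f s \<in> borel_measurable (F s)"
      using assms(7) s by (rule progressively_measurable_adapted)
    show "ext_integral Q (\<lambda>\<omega>. ereal \<sigma> * f s \<omega>) \<le> K s"
      unfolding K_def
    proof (intro INF_greatest)
      fix c :: real assume "c \<in> {0<..}"
      have "cgf P (\<lambda>\<omega>. ereal \<sigma> * f s \<omega>) c = cgf P (f s) (\<sigma> * c)"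
        by (simp add: cgf_def mult.assoc[symmetric] mult.commute[of \<sigma>])
      then show "ext_integral Q (\<lambda>\<omega>. ereal \<sigma> * f s \<omega>)
          \<le> ereal (1 / c) * cgf P (f s) (\<sigma> * c) + ereal (1 / c) * R s"
        using donsker_varadhan_subalgebra[OF assms(2,4) sub[OF s], of "\<lambda>\<omega>. ereal \<sigma> * f s \<omega>" c]
          \<open>c \<in> {0<..}\<close> by (simp add: R_def)
    qed
  qed
  finally have first: "ereal \<sigma> * ext_integral Q (\<lambda>\<omega>. ext_integral N (\<lambda>s. f s \<omega>)) \<le> ext_integral N K" .

  have second: "ext_integral N K \<le> (INF c\<in>{0<..}.
      ext_integral N (\<lambda>s. ereal (1 / c) * cgf P (f s) (\<sigma> * c)) + ereal (1 / c) * ext_integral N R)"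
  proof (intro INF_greatest)
    fix c :: real assume c: "c \<in> {0<..}"
    have [measurable]: "(\<lambda>s. cgf P (f s) (\<sigma> * c)) \<in> borel_measurable N"
      using P.sigma_finite_measure_axioms fP by (rule borel_measurable_cgf)
    have "ext_integral N K \<le> ext_integral N (\<lambda>s. ereal (1 / c) * cgf P (f s) (\<sigma> * c) + ereal (1 / c) * R s)"
      unfolding K_def using c by (intro ext_integral_mono INF_lower)
    also have "\<dots> \<le> ext_integral N (\<lambda>s. ereal (1 / c) * cgf P (f s) (\<sigma> * c))
        + ext_integral N (\<lambda>s. ereal (1 / c) * R s)"
      using c R_nonneg by (intro ext_integral_add_le) (auto simp: space_N)
    also have "ext_integral N (\<lambda>s. ereal (1 / c) * R s) = ereal (1 / c) * ext_integral N R"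
      using c by (intro ext_integral_cmult) auto
    finally show "ext_integral N K \<le> ext_integral N (\<lambda>s. ereal (1 / c) * cgf P (f s) (\<sigma> * c))
        + ereal (1 / c) * ext_integral N R" .
  qed
  show ?thesis
    using first second unfolding K_def R_def N_def by (intro conjI)
qed

end
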